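(* Let $m,n,s$ be positive integers and let $\Phi\in\mathbb{R}^{m\times n}$ satisfy the $2s$-restricted isometry property with a constant $\delta_{2s}<\frac{1}{3}$. Then for any $x\in\mathbb{H}^n$ and $y=\Phi x\in\mathbb{H}^m$, every solution $x^{\#}\in\mathbb{H}^n$ of the problem $$\operatorname*{arg\,min}_{z\in\mathbb{H}^n}\|z\|_1\quad\text{subject to}\quad\Phi z=y$$ satisfies $$\|x^{\#}-x\|_1\leq C_0\,\|x-x|_s\|_1$$ and $$\|x^{\#}-x\|_2\leq\frac{C_0}{\sqrt{s}}\,\|x-x|_s\|_1$$ with constant $$C_0=\frac{2(1+\delta_{2s})}{1-3\delta_{2s}},$$ where $x|_s$ denotes the best $s$-sparse approximation of $x$. In particular, if $x$ is $s$-sparse, then the reconstruction by $\ell_1$ minimization is exact, i.e. $x^{\#}=x$.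
   Context: $\mathbb{H}$ denotes the algebra of quaternions $q=a+b\mathbf{i}+c\mathbf{j}+d\mathbf{k}$, $a,b,c,d\in\mathbb{R}$, with norm $|q|=\sqrt{a^2+b^2+c^2+d^2}$. For $x=(x_1,\ldots,x_n)^T\in\mathbb{H}^n$ and $p\in[1,\infty)$, $\|x\|_p=\left(\sum_{i=1}^n|x_i|^p\right)^{1/p}$. A real matrix $\Phi\in\mathbb{R}^{m\times n}$ acts on $\mathbb{H}^n$ by the usual matrix-vector product, with real numbers regarded as quaternions. A vector (real or quaternion) is called $s$-sparse if it has at most $s$ nonzero coordinates. Restricted isometry property: for a positive integer $r$, $\Phi\in\mathbb{R}^{m\times n}$ satisfies the $r$-restricted isometry property (for real vectors) with a constant $\delta_r\geq0$ if $(1-\delta_r)\|v\|_2^2\leq\|\Phi v\|_2^2\leq(1+\delta_r)\|v\|_2^2$ for all $r$-sparse real vectors $v\in\mathbb{R}^n$. Best $s$-sparse approximation: $x|_s$ is the vector that agrees with $x$ on the set $T_0$ of indices of the $s$ coordinates of $x$ with the biggest quaternion norms $|x_i|$ (ties broken arbitrarily; all indices if $s\ge n$) and is zero at all other indices. *)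

theory Defs
  imports "HOL-Analysis.Analysis"
begin

section \<open>The real algebra of quaternions\<close>

codatatype quat = Quat (Re_q: real) (Im1: real) (Im2: real) (Im3: real)

lemma quat_eq_iff:
  "p = q \<longleftrightarrow> Re_q p = Re_q q \<and> Im1 p = Im1 q \<and> Im2 p = Im2 q \<and> Im3 p = Im3 q"
  by (cases p; cases q) simp

instantiation quat :: ring_1
begin

primcorec zero_quat where
  "Re_q 0 = 0" | "Im1 0 = 0" | "Im2 0 = 0" | "Im3 0 = 0"

primcorec one_quat where
  "Re_q 1 = 1" | "Im1 1 = 0" | "Im2 1 = 0" | "Im3 1 = 0"

primcorec plus_quat where
  "Re_q (p + q) = Re_q p + Re_q q"
| "Im1 (p + q) = Im1 p + Im1 q"
| "Im2 (p + q) = Im2 p + Im2 q"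
| "Im3 (p + q) = Im3 p + Im3 q"

primcorec uminus_quat where
  "Re_q (- q) = - Re_q q"
| "Im1 (- q) = - Im1 q"
| "Im2 (- q) = - Im2 q"
| "Im3 (- q) = - Im3 q"

primcorec minus_quat where
  "Re_q (p - q) = Re_q p - Re_q q"
| "Im1 (p - q) = Im1 p - Im1 q"
| "Im2 (p - q) = Im2 p - Im2 q"
| "Im3 (p - q) = Im3 p - Im3 q"

primcorec times_quat where
  "Re_q (p * q) = Re_q p * Re_q q - Im1 p * Im1 q - Im2 p * Im2 q - Im3 p * Im3 q"
| "Im1 (p * q) = Re_q p * Im1 q + Im1 p * Re_q q + Im2 p * Im3 q - Im3 p * Im2 q"
| "Im2 (p * q) = Re_q p * Im2 q - Im1 p * Im3 q + Im2 p * Re_q q + Im3 p * Im1 q"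
| "Im3 (p * q) = Re_q p * Im3 q + Im1 p * Im2 q - Im2 p * Im1 q + Im3 p * Re_q q"

instance
  by standard (simp_all add: quat_eq_iff algebra_simps)

end

instantiation quat :: real_algebra_1
begin

primcorec scaleR_quat where
  "Re_q (r *\<^sub>R q) = r * Re_q q"
| "Im1 (r *\<^sub>R q) = r * Im1 q"
| "Im2 (r *\<^sub>R q) = r * Im2 q"
| "Im3 (r *\<^sub>R q) = r * Im3 q"

instance
  by standard (simp_all add: quat_eq_iff algebra_simps)

end

instantiation quat :: real_normed_algebra_1
begin

definition norm_quat_def:
  "norm (q :: quat) = sqrt ((Re_q q)\<^sup>2 + (Im1 q)\<^sup>2 + (Im2 q)\<^sup>2 + (Im3 q)\<^sup>2)"

definition sgn_quat_def:
  "sgn (q :: quat) = q /\<^sub>R norm q"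

definition dist_quat_def:
  "dist (p :: quat) q = norm (p - q)"

definition uniformity_quat_def:
  "(uniformity :: (quat \<times> quat) filter) = (INF e\<in>{0<..}. principal {(p, q). dist p q < e})"

definition open_quat_def:
  "open (U :: quat set) \<longleftrightarrow> (\<forall>p\<in>U. eventually (\<lambda>(p', q). p' = p \<longrightarrow> q \<in> U) uniformity)"

lemma norm_quat_eq_norm_prod:
  "norm q = norm ((Re_q q, Im1 q), (Im2 q, Im3 q))"
  by (simp add: norm_quat_def norm_prod_def)

lemma norm_mult_quat: "norm (p * q) = norm p * norm (q :: quat)"
proof -
  have "(Re_q (p * q))\<^sup>2 + (Im1 (p * q))\<^sup>2 + (Im2 (p * q))\<^sup>2 + (Im3 (p * q))\<^sup>2 =
    ((Re_q p)\<^sup>2 + (Im1 p)\<^sup>2 + (Im2 p)\<^sup>2 + (Im3 p)\<^sup>2) *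
    ((Re_q q)\<^sup>2 + (Im1 q)\<^sup>2 + (Im2 q)\<^sup>2 + (Im3 q)\<^sup>2)"
    unfolding times_quat.sel by algebra
  then show ?thesis
    by (simp add: norm_quat_def real_sqrt_mult)
qed

instance
proof
  fix p q :: quat and r :: real
  show "norm q = 0 \<longleftrightarrow> q = 0"
    by (simp add: norm_quat_eq_norm_prod quat_eq_iff zero_prod_def)
  show "norm (p + q) \<le> norm p + norm q"
    using norm_triangle_ineq[of "((Re_q p, Im1 p), (Im2 p, Im3 p))" "((Re_q q, Im1 q), (Im2 q, Im3 q))"]
    by (simp add: norm_quat_eq_norm_prod)
  show "norm (r *\<^sub>R q) = \<bar>r\<bar> * norm q"
    using norm_scaleR[of r "((Re_q q, Im1 q), (Im2 q, Im3 q))"]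
    by (simp add: norm_quat_eq_norm_prod)
  show "norm (p * q) \<le> norm p * norm q"
    by (simp add: norm_mult_quat)
  show "norm (1 :: quat) = 1"
    by (simp add: norm_quat_def)
qed (simp_all add: sgn_quat_def dist_quat_def uniformity_quat_def open_quat_def)

end

definition qi :: quat where "qi = Quat 0 1 0 0"
definition qj :: quat where "qj = Quat 0 0 1 0"
definition qk :: quat where "qk = Quat 0 0 0 1"

lemma quat_units:
  "qi * qi = -1" "qj * qj = -1" "qk * qk = -1"
  "qi * qj = qk" "qj * qk = qi" "qk * qi = qj"
  "qj * qi = -qk" "qk * qj = -qi" "qi * qk = -qj"
  by (simp_all add: quat_eq_iff qi_def qj_def qk_def)

lemma Quat_conv_units:
  "Quat a b c d = of_real a + of_real b * qi + of_real c * qj + of_real d * qk"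
  by (simp add: quat_eq_iff of_real_def qi_def qj_def qk_def)


section \<open>Compressed sensing notions\<close>

definition lp_norm :: "real \<Rightarrow> 'a::real_normed_vector ^ 'n \<Rightarrow> real" where
  "lp_norm p x = (\<Sum>i\<in>UNIV. norm (x $ i) powr p) powr (1 / p)"

lemma lp_norm_1: "lp_norm 1 x = (\<Sum>i\<in>UNIV. norm (x $ i))"
  by (simp add: lp_norm_def sum_nonneg)

lemma lp_norm_2: "lp_norm 2 x = norm x"
  by (simp add: lp_norm_def norm_vec_def L2_set_def powr_half_sqrt sum_nonneg)

definition sparse_vec :: "nat \<Rightarrow> 'a::zero ^ 'n \<Rightarrow> bool" where
  "sparse_vec s x \<longleftrightarrow> card {i. x $ i \<noteq> 0} \<le> s"

definition real_mat_act :: "real ^ 'n ^ 'm \<Rightarrow> quat ^ 'n \<Rightarrow> quat ^ 'm" where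
  "real_mat_act \<Phi> z = map_matrix of_real \<Phi> *v z"

text \<open>\<^term>\<open>\<delta>\<close> is any admissible constant, not necessarily the smallest one.\<close>
definition satisfies_rip :: "nat \<Rightarrow> real ^ 'n ^ 'm \<Rightarrow> real \<Rightarrow> bool" where
  "satisfies_rip r \<Phi> \<delta> \<longleftrightarrow> 0 \<le> \<delta> \<and>
     (\<forall>v :: real ^ 'n. sparse_vec r v \<longrightarrow>
        (1 - \<delta>) * (lp_norm 2 v)\<^sup>2 \<le> (lp_norm 2 (\<Phi> *v v))\<^sup>2 \<and>
        (lp_norm 2 (\<Phi> *v v))\<^sup>2 \<le> (1 + \<delta>) * (lp_norm 2 v)\<^sup>2)"

text \<open>A relation rather than a function: ties between coordinates of equal norm may be
  broken arbitrarily, so several vectors can be best \<open>s\<close>-sparse approximations of \<open>x\<close>.\<close>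
definition best_sparse_approx :: "nat \<Rightarrow> 'a::real_normed_vector ^ 'n \<Rightarrow> 'a ^ 'n \<Rightarrow> bool" where
  "best_sparse_approx s x w \<longleftrightarrow>
     (\<exists>T :: 'n set. card T = min s CARD('n) \<and>
        (\<forall>i\<in>T. \<forall>j\<in>-T. norm (x $ j) \<le> norm (x $ i)) \<and>
        w = (\<chi> i. if i \<in> T then x $ i else 0))"

end

theory Submission
  imports Defs
begin

text \<open>
  A real matrix acts on the four real components of a quaternion vector separately, so it satisfies
  the restricted isometry property on quaternion vectors with the same constant \<open>\<delta>\<close>. By
  polarization with respect to the real inner product, images of disjointly supported \<open>s\<close>-sparse
  vectors are then almost orthogonal. Let \<open>h\<close> be the reconstruction error, \<open>T\<close> the support of the
  best approximation and \<open>W\<close> the union of \<open>T\<close> with the \<open>s\<close> largest coordinates of \<open>h\<close> outside \<open>T\<close>.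
  Cutting the complement of \<open>W\<close> into blocks of \<open>s\<close> coordinates of decreasing size, as Candes does,
  yields \<open>(1 - \<delta>) * sqrt s * \<parallel>h\<^sub>W\<parallel>\<^sub>2 \<le> 2 * \<delta> * \<parallel>h\<^bsub>-T\<^esub>\<parallel>\<^sub>1\<close>. Minimality gives
  \<open>\<parallel>h\<^bsub>-T\<^esub>\<parallel>\<^sub>1 \<le> \<parallel>h\<^sub>T\<parallel>\<^sub>1 + 2 * \<parallel>x - x\<^sub>s\<parallel>\<^sub>1\<close>, and the two inequalities combine to the claim.
\<close>

section \<open>Quaternions as a real inner product space\<close>

text \<open>With this instance \<open>quat ^ 'n\<close> becomes a real inner product space, so
  polarization works despite noncommutative multiplication.\<close>

instantiation quat :: real_inner
begin

definition inner_quat_def: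
  "inner p q = Re_q p * Re_q q + Im1 p * Im1 q + Im2 p * Im2 q + Im3 p * Im3 q"

instance
proof
  fix p q r :: quat and a :: real
  show "p \<bullet> q = q \<bullet> p" "(p + q) \<bullet> r = p \<bullet> r + q \<bullet> r" "(a *\<^sub>R p) \<bullet> q = a * (p \<bullet> q)"
    by (simp_all add: inner_quat_def algebra_simps)
  show "0 \<le> p \<bullet> p"
    by (simp add: inner_quat_def)
  show norm_eq: "norm p = sqrt (p \<bullet> p)" for p :: quat
    by (simp add: inner_quat_def norm_quat_def power2_eq_square)
  show "p \<bullet> p = 0 \<longleftrightarrow> p = 0"
    using norm_eq[of p] by (metis norm_eq_zero real_sqrt_eq_zero_cancel_iff)
qed

end


section \<open>Restriction of vectors to a set of indices\<close>

definition restrict_vec :: "'n set \<Rightarrow> 'a::zero ^ 'n \<Rightarrow> 'a ^ 'n" where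
  "restrict_vec S h = (\<chi> i. if i \<in> S then h $ i else 0)"

lemma restrict_vec_nth [simp]: "restrict_vec S h $ i = (if i \<in> S then h $ i else 0)"
  by (simp add: restrict_vec_def)

lemma restrict_vec_UNIV [simp]: "restrict_vec UNIV h = h"
  by (simp add: vec_eq_iff)

lemma restrict_vec_Un_disjoint:
  fixes h :: "'a::monoid_add ^ 'n"
  assumes "S \<inter> T = {}"
  shows "restrict_vec (S \<union> T) h = restrict_vec S h + restrict_vec T h"
  using assms by (auto simp: vec_eq_iff)

lemma norm_vec_power2: "(norm (v :: 'a::real_normed_vector ^ 'n))\<^sup>2 = (\<Sum>i\<in>UNIV. (norm (v $ i))\<^sup>2)"
  by (simp add: norm_vec_def L2_set_def sum_nonneg)

lemma norm_restrict_vec: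
  fixes h :: "'a::real_normed_vector ^ 'n"
  shows "norm (restrict_vec S h) = L2_set (\<lambda>i. norm (h $ i)) S"
proof -
  have "(\<Sum>i\<in>UNIV. (norm (restrict_vec S h $ i))\<^sup>2) = (\<Sum>i\<in>S. (norm (h $ i))\<^sup>2)"
    by (rule sum.mono_neutral_cong_right) auto
  then show ?thesis
    by (simp add: norm_vec_def L2_set_def)
qed

lemma L2_set_subset_mono:
  assumes "finite T" "S \<subseteq> T"
  shows "L2_set f S \<le> L2_set f T"
  unfolding L2_set_def using assms by (intro real_sqrt_le_mono sum_mono2) auto

lemma sum_le_sqrt_L2_set:
  fixes f :: "'i \<Rightarrow> real"
  assumes "card T \<le> s"
  shows "sum f T \<le> sqrt (real s) * L2_set f T"
proof -
  have "(sum f T)\<^sup>2 \<le> (\<Sum>i\<in>T. (f i)\<^sup>2) * real (card T)"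
    by (rule sum_squared_le_sum_of_squares)
  also have "\<dots> \<le> (\<Sum>i\<in>T. (f i)\<^sup>2) * real s"
    using assms by (intro mult_left_mono sum_nonneg) auto
  finally have "\<bar>sum f T\<bar> \<le> sqrt ((\<Sum>i\<in>T. (f i)\<^sup>2) * real s)"
    by (rule real_le_rsqrt[of "\<bar>_\<bar>", simplified])
  then show ?thesis
    by (simp add: L2_set_def real_sqrt_mult mult.commute)
qed


section \<open>Block decomposition by decreasing size\<close>

lemma ex_largest_subset:
  fixes f :: "'i \<Rightarrow> 'b::linorder"
  assumes "finite A" "k \<le> card A"
  shows "\<exists>T\<subseteq>A. card T = k \<and> (\<forall>i\<in>T. \<forall>j\<in>A - T. f j \<le> f i)"
  using assms(2)
proof (induction k)
  case 0
  then show ?case by (intro exI[of _ "{}"]) simp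
next
  case (Suc k)
  then obtain T where T: "T \<subseteq> A" "card T = k" "\<forall>i\<in>T. \<forall>j\<in>A - T. f j \<le> f i"
    by auto
  have "finite (A - T)" "A - T \<noteq> {}"
    using assms(1) Suc.prems T(1,2) by auto
  then have "Max (f ` (A - T)) \<in> f ` (A - T)" "\<forall>j\<in>A - T. f j \<le> Max (f ` (A - T))"
    by simp_all
  then obtain m where m: "m \<in> A - T" "\<forall>j\<in>A - T. f j \<le> f m"
    by auto
  have "card (insert m T) = Suc k"
    using m(1) T(1,2) assms(1) by (simp add: finite_subset)
  then show ?case
    using T m by (intro exI[of _ "insert m T"]) auto
qed

text \<open>Every value on \<open>S\<close> is at most the average of \<open>f\<close> over
  \<open>T\<close>, and at most \<open>s\<close> copies of that average have l2 norm at most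
  \<open>sqrt s\<close> times it.\<close>

lemma L2_set_le_sum_of_dominating:
  fixes f :: "'i \<Rightarrow> real"
  assumes "0 < s" "card S \<le> s" "card T = s"
    and "\<And>i. i \<in> S \<Longrightarrow> 0 \<le> f i" "\<And>i j. i \<in> T \<Longrightarrow> j \<in> S \<Longrightarrow> f j \<le> f i"
    and "\<And>i. i \<in> T \<Longrightarrow> 0 \<le> f i"
  shows "L2_set f S \<le> sum f T / sqrt (real s)"
proof -
  define M where "M = sum f T / real s"
  have M: "0 \<le> M"
    using assms by (simp add: M_def sum_nonneg)
  have le: "f j \<le> M" if "j \<in> S" for j
    using sum_bounded_below[of T "f j" f] assms that by (simp add: M_def field_simps)
  have "(\<Sum>j\<in>S. (f j)\<^sup>2) \<le> real (card S) * M\<^sup>2"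
    using le assms(4) by (intro sum_bounded_above power_mono) auto
  also have "\<dots> \<le> real s * M\<^sup>2"
    using assms(2) by (intro mult_right_mono) auto
  finally have "L2_set f S \<le> sqrt (real s * M\<^sup>2)"
    unfolding L2_set_def by (rule real_sqrt_le_mono)
  also have "\<dots> = sqrt (real s) * M"
    using M by (simp add: real_sqrt_mult)
  also have "\<dots> = sum f T / sqrt (real s)"
    using assms(1) by (simp add: M_def field_simps)
  finally show ?thesis .
qed

text \<open>Exactly the properties of a set function that the block argument uses: subadditivity to
  split into blocks, and an l2 bound on each single block.\<close>

definition blockwise_bounded ::
    "nat \<Rightarrow> ('i \<Rightarrow> real) \<Rightarrow> 'i set \<Rightarrow> real \<Rightarrow> ('i set \<Rightarrow> real) \<Rightarrow> bool" where
  "blockwise_bounded s f A c F \<longleftrightarrow> 0 \<le> c \<and>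
    (\<forall>S U. S \<subseteq> A \<longrightarrow> U \<subseteq> A \<longrightarrow> S \<inter> U = {} \<longrightarrow> F (S \<union> U) \<le> F S + F U) \<and>
    (\<forall>S. S \<subseteq> A \<longrightarrow> card S \<le> s \<longrightarrow> F S \<le> c * L2_set f S)"

lemma blockwise_bounded_subset:
  "blockwise_bounded s f A c F \<Longrightarrow> B \<subseteq> A \<Longrightarrow> blockwise_bounded s f B c F"
  unfolding blockwise_bounded_def by (meson order_trans)

text \<open>The inductive step of the decomposition: each block is paid for by its predecessor. The
  block \<open>T'\<close> costs at most the sum over the dominating block \<open>T\<close>, the rest
  at most the sum over \<open>A - T\<close>. This shift is why the first block is missing on the
  left.\<close>

lemma blockwise_bounded_tail:
  assumes "finite A" "T \<subseteq> A" "card T = s" "0 < s" "\<And>i. 0 \<le> f i"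
    and T': "T' \<subseteq> A - T" "card T' \<le> s"
    and dom: "\<And>i j. i \<in> T \<Longrightarrow> j \<in> A - T \<Longrightarrow> f j \<le> f i"
    and F: "blockwise_bounded s f A c F"
    and tail: "F (A - T - T') \<le> c * sum f (A - T) / sqrt (real s)"
  shows "F (A - T) \<le> c * sum f A / sqrt (real s)"
proof -
  have c: "0 \<le> c"
    using F by (simp add: blockwise_bounded_def)
  have "F (T' \<union> (A - T - T')) \<le> F T' + F (A - T - T')"
  proof -
    have "T' \<subseteq> A" "A - T - T' \<subseteq> A" "T' \<inter> (A - T - T') = {}"
      using T'(1) by auto
    then show ?thesis
      using F unfolding blockwise_bounded_def by blast
  qed
  moreover have "T' \<union> (A - T - T') = A - T"
    using T'(1) by auto
  moreover have "F T' \<le> c * L2_set f T'"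
    using F T' unfolding blockwise_bounded_def by blast
  moreover have "L2_set f T' \<le> sum f T / sqrt (real s)"
    using assms(3-5) T' dom by (intro L2_set_le_sum_of_dominating) auto
  then have "c * L2_set f T' \<le> c * (sum f T / sqrt (real s))"
    using c by (rule mult_left_mono)
  moreover have "sum f A = sum f (A - T) + sum f T"
    using assms(1,2) by (intro sum.subset_diff)
  ultimately show ?thesis
    using tail by (simp add: distrib_left add_divide_distrib)
qed

text \<open>Quantifying over \<open>F\<close> makes a single block \<open>T\<close> serve both for the norm of the tail and for its
  correlation with a fixed vector.\<close>
lemma ex_block_tail_bound:
  fixes f :: "'i \<Rightarrow> real"
  assumes "finite A" "0 < s" "\<And>i. 0 \<le> f i"
  shows "\<exists>T\<subseteq>A. card T \<le> s \<and>
    (\<forall>F c. blockwise_bounded s f A c F \<longrightarrow> F (A - T) \<le> c * sum f A / sqrt (real s))"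
  using assms(1)
proof (induction "card A" arbitrary: A rule: less_induct)
  case less
  show ?case
  proof (cases "card A \<le> s")
    case True
    \<comment> \<open>One block exhausts \<open>A\<close>, and the l2 bound on the empty block gives
      \<open>F {} \<le> 0\<close>.\<close>
    have "F (A - A) \<le> c * sum f A / sqrt (real s)" if F: "blockwise_bounded s f A c F" for F c
    proof -
      have "F {} \<le> c * L2_set f {}"
        using F unfolding blockwise_bounded_def by (metis card.empty empty_subsetI zero_le)
      also have "\<dots> \<le> c * sum f A / sqrt (real s)"
        using F assms(3) by (simp add: blockwise_bounded_def sum_nonneg)
      finally show ?thesis by simp
    qed
    then show ?thesis
      using True by blast
  next
    case False
    then obtain T where T: "T \<subseteq> A" "card T = s" "\<forall>i\<in>T. \<forall>j\<in>A - T. f j \<le> f i"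
      using ex_largest_subset[OF less.prems, of s f] by auto
    have "card (A - T) < card A"
      using T(1,2) False assms(2) less.prems by (simp add: card_Diff_subset finite_subset)
    \<comment> \<open>Nothing about the order within \<open>A - T\<close> has to be remembered:
      \<open>T\<close> dominates all of it, hence also \<open>T'\<close>.\<close>
    from less.hyps[OF this] less.prems obtain T' where T': "T' \<subseteq> A - T" "card T' \<le> s"
      and tail: "\<forall>F c. blockwise_bounded s f (A - T) c F \<longrightarrow>
        F (A - T - T') \<le> c * sum f (A - T) / sqrt (real s)"
      by auto
    have "F (A - T) \<le> c * sum f A / sqrt (real s)" if F: "blockwise_bounded s f A c F" for F c
    proof (rule blockwise_bounded_tail[OF less.prems T(1,2) assms(2,3) T' _ F])
      show "f j \<le> f i" if "i \<in> T" "j \<in> A - T" for i j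
        using T(3) that by blast
      show "F (A - T - T') \<le> c * sum f (A - T) / sqrt (real s)"
        using tail blockwise_bounded_subset[OF F, of "A - T"] by blast
    qed
    then show ?thesis
      using T(1,2) by blast
  qed
qed


section \<open>The restricted isometry property on quaternion vectors\<close>

lemma real_mat_act_nth: "real_mat_act \<Phi> z $ i = (\<Sum>j\<in>UNIV. (\<Phi> $ i $ j) *\<^sub>R z $ j)"
  by (simp add: real_mat_act_def matrix_vector_mult_def map_matrix_def scaleR_conv_of_real)

lemma linear_real_mat_act: "linear (real_mat_act \<Phi>)"
  by (rule linearI)
    (simp_all add: vec_eq_iff real_mat_act_nth scaleR_add_right sum.distrib scaleR_right.sum mult.commute)

text \<open>The entries of \<Phi> are real, so they pass through every real-linear functional on the
  quaternions.\<close>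

lemma matrix_vector_mult_component:
  fixes c :: "quat \<Rightarrow> real"
  assumes "linear c"
  shows "\<Phi> *v (\<chi> i. c (z $ i)) = (\<chi> i. c (real_mat_act \<Phi> z $ i))"
  using assms
  by (simp add: vec_eq_iff real_mat_act_nth matrix_vector_mult_def linear_sum linear_cmul)

lemma linear_quat_components:
  "linear Re_q" "linear Im1" "linear Im2" "linear Im3"
  by (auto intro!: linearI)

lemma norm_quat_vec_power2:
  fixes z :: "quat ^ 'n"
  shows "(norm z)\<^sup>2 = (norm (\<chi> i. Re_q (z $ i)))\<^sup>2 + (norm (\<chi> i. Im1 (z $ i)))\<^sup>2
    + (norm (\<chi> i. Im2 (z $ i)))\<^sup>2 + (norm (\<chi> i. Im3 (z $ i)))\<^sup>2"
  by (simp add: norm_vec_power2 norm_quat_def sum.distrib)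

text \<open>Each of the four component vectors inherits the sparsity of \<open>z\<close>; adding
  their inequalities keeps the constant, since squared norms add up.\<close>

lemma satisfies_rip_quat:
  fixes z :: "quat ^ 'n"
  assumes rip: "satisfies_rip r \<Phi> \<delta>" and z: "sparse_vec r z"
  shows "(1 - \<delta>) * (norm z)\<^sup>2 \<le> (norm (real_mat_act \<Phi> z))\<^sup>2"
    and "(norm (real_mat_act \<Phi> z))\<^sup>2 \<le> (1 + \<delta>) * (norm z)\<^sup>2"
proof -
  have comp: "(1 - \<delta>) * (norm (\<chi> i. c (z $ i)))\<^sup>2 \<le> (norm (\<chi> i. c (real_mat_act \<Phi> z $ i)))\<^sup>2 \<and>
      (norm (\<chi> i. c (real_mat_act \<Phi> z $ i)))\<^sup>2 \<le> (1 + \<delta>) * (norm (\<chi> i. c (z $ i)))\<^sup>2"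
    if c: "linear c" for c :: "quat \<Rightarrow> real"
  proof -
    have "{i. (\<chi> i. c (z $ i)) $ i \<noteq> 0} \<subseteq> {i. z $ i \<noteq> 0}"
      using linear_0[OF c] by auto
    then have "sparse_vec r (\<chi> i. c (z $ i))"
      using z unfolding sparse_vec_def by (meson card_mono finite order_trans)
    then show ?thesis
      using rip unfolding satisfies_rip_def lp_norm_2 matrix_vector_mult_component[OF c, symmetric]
      by blast
  qed
  note * = linear_quat_components[THEN comp]
  show "(1 - \<delta>) * (norm z)\<^sup>2 \<le> (norm (real_mat_act \<Phi> z))\<^sup>2"
    "(norm (real_mat_act \<Phi> z))\<^sup>2 \<le> (1 + \<delta>) * (norm z)\<^sup>2"
    using * unfolding norm_quat_vec_power2[of z] norm_quat_vec_power2[of "real_mat_act \<Phi> z"]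
    by (simp_all add: distrib_left)
qed

lemma sparse_vecI:
  assumes "\<And>i. i \<notin> S \<Longrightarrow> z $ i = 0" "card S \<le> r"
  shows "sparse_vec r (z :: 'a::zero ^ 'n)"
proof -
  have "{i. z $ i \<noteq> 0} \<subseteq> S"
    using assms(1) by auto
  then show ?thesis
    using assms(2) card_mono[of S] unfolding sparse_vec_def by (meson finite order_trans)
qed

text \<open>Polarization: four times the inner product is the difference of the squared norms of the
  images of \<open>u + v\<close> and \<open>u - v\<close>. Both vectors have squared norm 2, so it
  is at most \<open>2 * (1 + \<delta>) - 2 * (1 - \<delta>) = 4 * \<delta>\<close>.\<close>

lemma rip_almost_orthogonal_unit:
  fixes u v :: "quat ^ 'n"
  assumes rip: "satisfies_rip r \<Phi> \<delta>"
    and supp: "\<And>i. i \<notin> S \<Longrightarrow> u $ i = 0" "\<And>i. i \<notin> T \<Longrightarrow> v $ i = 0"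
    and ST: "S \<inter> T = {}" "card (S \<union> T) \<le> r"
    and unit: "norm u = 1" "norm v = 1"
  shows "real_mat_act \<Phi> u \<bullet> real_mat_act \<Phi> v \<le> \<delta>"
proof -
  have "u $ i \<bullet> v $ i = 0" for i
  proof -
    have "i \<notin> S \<or> i \<notin> T"
      using ST(1) by auto
    then show ?thesis
      using supp by auto
  qed
  then have orth: "u \<bullet> v = 0"
    by (simp add: inner_vec_def)
  have "(u + v) $ i = 0" "(u - v) $ i = 0" if "i \<notin> S \<union> T" for i
    using that supp[of i] by simp_all
  then have "sparse_vec r (u + v)" "sparse_vec r (u - v)"
    using ST(2) by (blast intro: sparse_vecI)+
  then have "(norm (real_mat_act \<Phi> (u + v)))\<^sup>2 \<le> (1 + \<delta>) * (norm (u + v))\<^sup>2"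
    "(1 - \<delta>) * (norm (u - v))\<^sup>2 \<le> (norm (real_mat_act \<Phi> (u - v)))\<^sup>2"
    by (simp_all add: satisfies_rip_quat[OF rip])
  moreover have "(norm (u + v))\<^sup>2 = 2" "(norm (u - v))\<^sup>2 = 2"
    using orth unit
    by (simp_all add: power2_norm_eq_inner inner_simps inner_commute norm_eq_1)
  ultimately show ?thesis
    by (simp add: linear_add[OF linear_real_mat_act] linear_diff[OF linear_real_mat_act]
        power2_norm_eq_inner inner_simps inner_commute)
qed

lemma rip_almost_orthogonal:
  fixes u v :: "quat ^ 'n"
  assumes rip: "satisfies_rip r \<Phi> \<delta>"
    and supp: "\<And>i. i \<notin> S \<Longrightarrow> u $ i = 0" "\<And>i. i \<notin> T \<Longrightarrow> v $ i = 0"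
    and ST: "S \<inter> T = {}" "card (S \<union> T) \<le> r"
  shows "\<bar>real_mat_act \<Phi> u \<bullet> real_mat_act \<Phi> v\<bar> \<le> \<delta> * norm u * norm v"
proof (cases "u = 0 \<or> v = 0")
  case True
  then show ?thesis
    using linear_0[OF linear_real_mat_act, of \<Phi>] by auto
next
  case False
  then have pos: "0 < norm u" "0 < norm v" by auto
  \<comment> \<open>Normalizing reduces to unit vectors; the case \<open>- v\<close> supplies the
    lower bound behind the absolute value.\<close>
  have le: "real_mat_act \<Phi> u \<bullet> real_mat_act \<Phi> w \<le> \<delta> * norm u * norm w"
    if w: "w = v \<or> w = - v" for w
  proof -
    have nz: "0 < norm w"
      using pos w by auto
    have "real_mat_act \<Phi> (u /\<^sub>R norm u) \<bullet> real_mat_act \<Phi> (w /\<^sub>R norm w) \<le> \<delta>"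
      using supp pos nz w
      by (intro rip_almost_orthogonal_unit[OF rip _ _ ST]) auto
    then show ?thesis
      using pos nz by (simp add: linear_cmul[OF linear_real_mat_act] field_simps)
  qed
  show ?thesis
    using le[of v] le[of "- v"] by (simp add: linear_neg[OF linear_real_mat_act])
qed


section \<open>Minimizers and best approximations\<close>

text \<open>The reverse triangle inequality is applied with opposite roles: \<open>x\<close>
  dominates on \<open>T\<close>, \<open>h\<close> off \<open>T\<close>. The mass of \<open>x\<close>
  on \<open>T\<close> then cancels.\<close>

lemma l1_cone_condition:
  fixes x h :: "'a::real_normed_vector ^ 'n"
  assumes "lp_norm 1 (x + h) \<le> lp_norm 1 x"
  shows "(\<Sum>i\<in>-T. norm (h $ i)) \<le> (\<Sum>i\<in>T. norm (h $ i)) + 2 * (\<Sum>i\<in>-T. norm (x $ i))"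
proof -
  have split: "(\<Sum>i\<in>UNIV. g i) = (\<Sum>i\<in>T. g i) + (\<Sum>i\<in>-T. g i)" for g :: "'n \<Rightarrow> real"
    using sum.subset_diff[of T UNIV g] by (simp add: Compl_eq_Diff_UNIV)
  have "(\<Sum>i\<in>T. norm (x $ i) - norm (h $ i)) \<le> (\<Sum>i\<in>T. norm ((x + h) $ i))"
    by (intro sum_mono) (simp add: norm_diff_ineq)
  moreover have "(\<Sum>i\<in>-T. norm (h $ i) - norm (x $ i)) \<le> (\<Sum>i\<in>-T. norm ((x + h) $ i))"
    by (intro sum_mono) (metis add.commute norm_diff_ineq vector_add_component)
  ultimately show ?thesis
    using assms unfolding lp_norm_1 split by (simp add: sum_subtractf)
qed

text \<open>A nonzero coordinate outside \<open>T\<close> would force all coordinates in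
  \<open>T\<close> to be nonzero, giving more than \<open>min s CARD('n)\<close> of them.\<close>

lemma best_sparse_approx_sparse:
  fixes x :: "'a::real_normed_vector ^ 'n"
  assumes best: "best_sparse_approx s x w" and sparse: "sparse_vec s x"
  shows "w = x"
proof -
  obtain T where T: "card T = min s CARD('n)" "\<forall>i\<in>T. \<forall>j\<in>-T. norm (x $ j) \<le> norm (x $ i)"
    and w: "w = (\<chi> i. if i \<in> T then x $ i else 0)"
    using best unfolding best_sparse_approx_def by blast
  have "x $ j = 0" if j: "j \<notin> T" for j
  proof (rule ccontr)
    assume nz: "x $ j \<noteq> 0"
    have "insert j T \<subseteq> {i. x $ i \<noteq> 0}"
      using T(2) j nz by force
    then have "card (insert j T) \<le> s"
      using sparse card_mono[OF finite] unfolding sparse_vec_def by (meson order_trans)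
    moreover have "card (insert j T) \<le> CARD('n)"
      by (intro card_mono) auto
    ultimately show False
      using j T(1) by simp
  qed
  then show ?thesis
    by (simp add: w vec_eq_iff)
qed

text \<open>A statement about the kernel of \<Phi> alone; minimality enters only later, through the
  cone condition.\<close>

lemma rip_null_space_bounds:
  fixes h :: "quat ^ 'n"
  assumes s: "0 < s" and rip: "satisfies_rip (2 * s) \<Phi> \<delta>" and \<delta>: "\<delta> \<le> 1"
    and null: "real_mat_act \<Phi> h = 0" and T: "card T \<le> s"
  defines "\<sigma> \<equiv> \<Sum>i\<in>-T. norm (h $ i)"
  shows "(1 - \<delta>) * (\<Sum>i\<in>T. norm (h $ i)) \<le> 2 * \<delta> * \<sigma>"
    and "(1 - \<delta>) * (sqrt (real s) * norm h) \<le> (1 + \<delta>) * \<sigma>"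
proof -
  define a where "a = (\<lambda>i. norm (h $ i))"
  let ?\<Phi> = "real_mat_act \<Phi>" and ?h = "\<lambda>S. restrict_vec S h" and ?r = "sqrt (real s)"
  note add = linear_add[OF linear_real_mat_act]
  have \<delta>0: "0 \<le> \<delta>"
    using rip by (simp add: satisfies_rip_def)
  have r: "0 < ?r"
    using s by simp
  \<comment> \<open>\<open>T1\<close> stands for the largest coordinates of \<open>h\<close> off
    \<open>T\<close>; only its size and the tail bound are kept.\<close>
  obtain T1 where T1: "T1 \<subseteq> -T" "card T1 \<le> s"
    and tail: "\<And>F c. blockwise_bounded s a (-T) c F \<Longrightarrow> F (-T - T1) \<le> c * sum a (-T) / ?r"
    using ex_block_tail_bound[of "-T" s a] s by (auto simp: a_def)
  define W R where "W = T \<union> T1" and "R = -T - T1"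
  have \<sigma>: "sum a (-T) = \<sigma>"
    by (simp add: a_def \<sigma>_def)
  have norm_h: "norm (?h S) = L2_set a S" for S
    by (simp add: norm_restrict_vec a_def)
  have "norm (?h (-T - T1)) \<le> 1 * sum a (-T) / ?r"
  proof (rule tail)
    show "blockwise_bounded s a (-T) 1 (\<lambda>S. norm (?h S))"
      unfolding blockwise_bounded_def
      by (simp add: restrict_vec_Un_disjoint norm_triangle_ineq) (simp add: norm_h)
  qed
  then have normR: "norm (?h R) \<le> \<sigma> / ?r"
    by (simp add: \<sigma> R_def)
  have corr: "\<bar>?\<Phi> (?h U) \<bullet> ?\<Phi> (?h R)\<bar> \<le> \<delta> * norm (?h W) * \<sigma> / ?r"
    if U: "U = T \<or> U = T1" for U
  proof -
    have cardU: "card U \<le> s"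
      using U T T1(2) by auto
    \<comment> \<open>Intersecting with \<open>R\<close> keeps every block disjoint from \<open>T1\<close>.\<close>
    have "\<bar>?\<Phi> (?h U) \<bullet> ?\<Phi> (?h ((-T - T1) \<inter> R))\<bar> \<le> (\<delta> * norm (?h U)) * sum a (-T) / ?r"
    proof (rule tail)
      have "\<bar>?\<Phi> (?h U) \<bullet> ?\<Phi> (?h ((S \<union> V) \<inter> R))\<bar>
          \<le> \<bar>?\<Phi> (?h U) \<bullet> ?\<Phi> (?h (S \<inter> R))\<bar> + \<bar>?\<Phi> (?h U) \<bullet> ?\<Phi> (?h (V \<inter> R))\<bar>"
        if "S \<inter> V = {}" for S V
      proof -
        have "?h ((S \<union> V) \<inter> R) = ?h (S \<inter> R) + ?h (V \<inter> R)"
          using that by (subst restrict_vec_Un_disjoint[symmetric]) (auto simp: Int_Un_distrib2)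
        then show ?thesis
          by (simp add: add inner_add_right)
      qed
      moreover have "\<bar>?\<Phi> (?h U) \<bullet> ?\<Phi> (?h (S \<inter> R))\<bar> \<le> \<delta> * norm (?h U) * L2_set a S"
        if "card S \<le> s" for S
      proof -
        have "card (U \<union> S \<inter> R) \<le> 2 * s"
          using card_Un_le[of U "S \<inter> R"] card_mono[of S "S \<inter> R"] cardU that by simp
        then have "\<bar>?\<Phi> (?h U) \<bullet> ?\<Phi> (?h (S \<inter> R))\<bar> \<le> \<delta> * norm (?h U) * norm (?h (S \<inter> R))"
          using U by (intro rip_almost_orthogonal[OF rip, of U _ "S \<inter> R"]) (auto simp: R_def)
        also have "\<dots> \<le> \<delta> * norm (?h U) * L2_set a S"
          unfolding norm_h[of "S \<inter> R"]
          using \<delta>0 by (intro mult_left_mono L2_set_subset_mono) simp_all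
        finally show ?thesis .
      qed
      ultimately show "blockwise_bounded s a (-T) (\<delta> * norm (?h U))
          (\<lambda>S. \<bar>?\<Phi> (?h U) \<bullet> ?\<Phi> (?h (S \<inter> R))\<bar>)"
        using \<delta>0 unfolding blockwise_bounded_def by simp
    qed
    also have "\<dots> \<le> (\<delta> * norm (?h W)) * sum a (-T) / ?r"
      using U \<delta>0 r unfolding norm_h
      by (intro divide_right_mono mult_right_mono mult_left_mono L2_set_subset_mono sum_nonneg)
        (auto simp: W_def a_def)
    finally show ?thesis
      by (simp add: R_def \<sigma>)
  qed
  have hW: "?h W = ?h T + ?h T1"
    unfolding W_def using T1(1) by (intro restrict_vec_Un_disjoint) auto
  have "W \<union> R = UNIV" "W \<inter> R = {}"
    by (auto simp: W_def R_def)
  then have h: "h = ?h W + ?h R"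
    by (metis restrict_vec_UNIV restrict_vec_Un_disjoint)
  then have "?\<Phi> (?h W) + ?\<Phi> (?h R) = 0"
    using null by (metis add)
  then have \<Phi>W: "?\<Phi> (?h W) = - ?\<Phi> (?h R)"
    by (simp add: eq_neg_iff_add_eq_0)
  have "sparse_vec (2 * s) (?h W)"
    using T T1(2) card_Un_le[of T T1] by (intro sparse_vecI[of W]) (auto simp: W_def)
  then have "(1 - \<delta>) * (norm (?h W))\<^sup>2 \<le> (norm (?\<Phi> (?h W)))\<^sup>2"
    by (rule satisfies_rip_quat[OF rip])
  also have "\<dots> = - (?\<Phi> (?h W) \<bullet> ?\<Phi> (?h R))"
    by (simp add: power2_norm_eq_inner \<Phi>W)
  also have "\<dots> = - (?\<Phi> (?h T) \<bullet> ?\<Phi> (?h R)) - ?\<Phi> (?h T1) \<bullet> ?\<Phi> (?h R)"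
    by (simp add: hW add inner_add_left)
  \<comment> \<open>One correlation each for \<open>T\<close> and \<open>T1\<close> gives the factor
    2, which later turns \<open>1 - \<delta>\<close> into \<open>1 - 3 * \<delta>\<close>.\<close>
  also have "\<dots> \<le> 2 * (\<delta> * norm (?h W) * \<sigma> / ?r)"
    using corr[of T, simplified] corr[of T1, simplified] by linarith
  finally have "((1 - \<delta>) * (?r * norm (?h W))) * norm (?h W) \<le> (2 * \<delta> * \<sigma>) * norm (?h W)"
    using r by (simp add: field_simps power2_eq_square)
  moreover have "0 \<le> \<sigma>"
    by (simp add: \<sigma>_def sum_nonneg)
  ultimately have W: "(1 - \<delta>) * (?r * norm (?h W)) \<le> 2 * \<delta> * \<sigma>"
    using \<delta>0 by (cases "norm (?h W) = 0") (auto simp: mult_le_cancel_right)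
  have "sum a T \<le> ?r * norm (?h T)"
    using sum_le_sqrt_L2_set[OF T] by (simp add: norm_h)
  also have "\<dots> \<le> ?r * norm (?h W)"
    using r by (intro mult_left_mono) (auto simp: norm_h W_def intro!: L2_set_subset_mono)
  finally have "(1 - \<delta>) * sum a T \<le> (1 - \<delta>) * (?r * norm (?h W))"
    using \<delta> by (intro mult_left_mono) auto
  with W show "(1 - \<delta>) * (\<Sum>i\<in>T. norm (h $ i)) \<le> 2 * \<delta> * \<sigma>"
    by (simp add: a_def)
  have "?r * norm h \<le> ?r * (norm (?h W) + norm (?h R))"
    using h r by (metis mult_left_mono norm_triangle_ineq less_imp_le)
  also have "\<dots> \<le> ?r * norm (?h W) + \<sigma>"
    using normR r by (simp add: field_simps)
  \<comment> \<open>The tail adds \<open>(1 - \<delta>) * \<sigma>\<close> to the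
    \<open>2 * \<delta> * \<sigma>\<close> from \<open>W\<close>, hence the factor
    \<open>1 + \<delta>\<close>.\<close>
  finally have "(1 - \<delta>) * (?r * norm h) \<le> (1 - \<delta>) * (?r * norm (?h W) + \<sigma>)"
    using \<delta> by (intro mult_left_mono) auto
  with W show "(1 - \<delta>) * (?r * norm h) \<le> (1 + \<delta>) * \<sigma>"
    by (simp add: algebra_simps)
qed

theorem corollary5p1:
  fixes \<Phi> :: "real ^ 'n ^ 'm"
    and x x_s x_opt :: "quat ^ 'n"
    and y :: "quat ^ 'm"
    and s :: nat
    and \<delta> C\<^sub>0 :: real
  assumes "s > 0"
    and "satisfies_rip (2 * s) \<Phi> \<delta>"
    and "\<delta> < 1 / 3"
    and "y = real_mat_act \<Phi> x"
    and "is_arg_min (lp_norm 1) (\<lambda>z. real_mat_act \<Phi> z = y) x_opt"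
    and "best_sparse_approx s x x_s"
    and "C\<^sub>0 = 2 * (1 + \<delta>) / (1 - 3 * \<delta>)"
  shows "lp_norm 1 (x_opt - x) \<le> C\<^sub>0 * lp_norm 1 (x - x_s)
    \<and> lp_norm 2 (x_opt - x) \<le> C\<^sub>0 / sqrt (real s) * lp_norm 1 (x - x_s)
    \<and> (sparse_vec s x \<longrightarrow> x_opt = x)"
proof -
  obtain T where T: "card T = min s CARD('n)"
    and x_s: "x_s = (\<chi> i. if i \<in> T then x $ i else 0)"
    using assms(6) unfolding best_sparse_approx_def by blast
  define h where "h = x_opt - x"
  define \<sigma> \<tau> e where "\<sigma> = (\<Sum>i\<in>-T. norm (h $ i))" and "\<tau> = (\<Sum>i\<in>T. norm (h $ i))"
    and "e = (\<Sum>i\<in>-T. norm (x $ i))"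
  have e: "lp_norm 1 (x - x_s) = e"
    unfolding lp_norm_1 e_def x_s by (rule sum.mono_neutral_cong_right) auto
  have \<delta>: "0 \<le> \<delta>" "0 < 1 - \<delta>" "0 < 1 - 3 * \<delta>"
    using assms(2,3) by (simp_all add: satisfies_rip_def)
  have null: "real_mat_act \<Phi> h = 0"
    using assms(4,5) by (simp add: h_def is_arg_min_def linear_diff[OF linear_real_mat_act])
  have "lp_norm 1 (x + h) \<le> lp_norm 1 x"
    using assms(4,5) by (auto simp: h_def is_arg_min_def not_less)
  then have cone: "\<sigma> \<le> \<tau> + 2 * e"
    unfolding \<sigma>_def \<tau>_def e_def by (rule l1_cone_condition)
  have "card T \<le> s"
    using T by simp
  note bounds = rip_null_space_bounds[OF assms(1,2) _ null this, folded \<sigma>_def \<tau>_def]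
  have \<tau>: "(1 - \<delta>) * \<tau> \<le> 2 * \<delta> * \<sigma>" and h2: "(1 - \<delta>) * (sqrt (real s) * norm h) \<le> (1 + \<delta>) * \<sigma>"
    using bounds \<delta>(2) by simp_all
  \<comment> \<open>The cone condition bounds \<sigma> by \<tau>, and \<tau> is bounded by \<sigma>
    again; the latter is absorbed on the left because \<open>3 * \<delta> < 1\<close>.\<close>
  have "(1 - \<delta>) * \<sigma> \<le> (1 - \<delta>) * (\<tau> + 2 * e)"
    using cone \<delta>(2) by (intro mult_left_mono) auto
  with \<tau> have "(1 - 3 * \<delta>) * \<sigma> \<le> (1 - \<delta>) * (2 * e)"
    by (simp add: algebra_simps)
  then have "\<sigma> \<le> (1 - \<delta>) * (2 * e) / (1 - 3 * \<delta>)"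
    using \<delta>(3) by (simp add: field_simps)
  \<comment> \<open>Both norm estimates reduce to this quantity: it bounds
    \<open>(1 - \<delta>) * (\<sigma> + \<tau>)\<close> as well as the left side of
    \<open>h2\<close>.\<close>
  then have "(1 + \<delta>) * \<sigma> \<le> (1 + \<delta>) * ((1 - \<delta>) * (2 * e) / (1 - 3 * \<delta>))"
    using \<delta>(1) by (intro mult_left_mono) auto
  also have "\<dots> = (1 - \<delta>) * (C\<^sub>0 * e)"
    by (simp add: assms(7))
  finally have \<sigma>: "(1 + \<delta>) * \<sigma> \<le> (1 - \<delta>) * (C\<^sub>0 * e)" .
  have "lp_norm 1 h = \<sigma> + \<tau>"
    using sum.subset_diff[of T UNIV "\<lambda>i. norm (h $ i)"]
    by (simp add: lp_norm_1 \<sigma>_def \<tau>_def Compl_eq_Diff_UNIV)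
  moreover have "(1 - \<delta>) * (\<sigma> + \<tau>) \<le> (1 - \<delta>) * (C\<^sub>0 * e)"
    using \<tau> \<sigma> by (simp add: algebra_simps)
  ultimately have 1: "lp_norm 1 h \<le> C\<^sub>0 * e"
    using \<delta>(2) by (simp add: mult_le_cancel_left_pos)
  have "(1 - \<delta>) * (sqrt (real s) * norm h) \<le> (1 - \<delta>) * (C\<^sub>0 * e)"
    using h2 \<sigma> by simp
  then have "sqrt (real s) * norm h \<le> C\<^sub>0 * e"
    using \<delta>(2) by (simp add: mult_le_cancel_left_pos)
  then have 2: "lp_norm 2 h \<le> C\<^sub>0 / sqrt (real s) * e"
    using assms(1) by (simp add: lp_norm_2 field_simps)
  have "x_opt = x" if "sparse_vec s x"
  proof -
    have "e = 0"
      using best_sparse_approx_sparse[OF assms(6) that] e by (simp add: lp_norm_1)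
    then show ?thesis
      using 2 by (simp add: lp_norm_2 h_def)
  qed
  with 1 2 show ?thesis
    by (simp add: e h_def)
qed

end
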